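(* Let $D$ be a finite digraph without loops and without parallel arcs in the same direction. If every directed cycle $B$ in $D$ has at least $\frac{1}{2}\|B\| + 1$ symmetric arcs, then $D$ has a $3$-kernel.
   Context: A digraph $D=(V(D),A(D))$ may contain both $(u,v)$ and $(v,u)$ as arcs. An arc $(u,v)$ of $D$ is symmetric if $(v,u)$ is also an arc of $D$; the number of symmetric arcs of a directed cycle $B$ is the number of arcs of $B$ that are symmetric in $D$. $\|B\|$ denotes the length (number of arcs) of $B$. $d_D(u,v)$ is the length of a shortest directed path from $u$ to $v$ ($\infty$ if none exists). A set $S \subseteq V(D)$ is $k$-independent if $d_D(u,v)\ge k$ for every two distinct $u,v\in S$ (in both directions), and $\ell$-absorbent if for every $u \in V(D)\setminus S$ there is $v\in S$ with $d_D(u,v)\le \ell$. A $k$-kernel is a $k$-independent and $(k-1)$-absorbent set; thus a $3$-kernel is a $3$-independent and $2$-absorbent set. *)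

theory Defs
  imports "Graph_Theory.Shortest_Path"
begin

lemma (in wf_digraph) awalk_cost_one: "awalk_cost (\<lambda>_. 1) p = real (length p)"
  by (induction p) simp_all

text \<open>
  The distance is the infimum of the lengths of all directed walks from \<open>u\<close> to \<open>v\<close>; it is
  \<open>\<infinity>\<close> if there is none. Shortest walks are paths, so allowing walks makes no difference.
\<close>

definition ddist :: "('a,'b) pre_digraph \<Rightarrow> 'a \<Rightarrow> 'a \<Rightarrow> ereal" where
  "ddist D u v = wf_digraph.\<mu> D (\<lambda>_. 1) u v"

lemma (in wf_digraph) ddist_conv: "ddist G u v = (INF p\<in>{p. awalk u p v}. ereal (real (length p)))"
  unfolding ddist_def \<mu>_def by (simp add: awalk_cost_one)

definition symmetric_arc :: "('a,'b) pre_digraph \<Rightarrow> 'b \<Rightarrow> bool" where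
  "symmetric_arc D a \<longleftrightarrow> a \<in> arcs D \<and> head D a \<rightarrow>\<^bsub>D\<^esub> tail D a"

definition num_symmetric_arcs :: "('a,'b) pre_digraph \<Rightarrow> 'b list \<Rightarrow> nat" where
  "num_symmetric_arcs D B = card {a \<in> set B. symmetric_arc D a}"

definition k_independent :: "('a,'b) pre_digraph \<Rightarrow> nat \<Rightarrow> 'a set \<Rightarrow> bool" where
  "k_independent D k S \<longleftrightarrow> S \<subseteq> verts D \<and>
     (\<forall>u\<in>S. \<forall>v\<in>S. u \<noteq> v \<longrightarrow> ereal (real k) \<le> ddist D u v)"

definition l_absorbent :: "('a,'b) pre_digraph \<Rightarrow> nat \<Rightarrow> 'a set \<Rightarrow> bool" where
  "l_absorbent D l S \<longleftrightarrow> S \<subseteq> verts D \<and>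
     (\<forall>u\<in>verts D - S. \<exists>v\<in>S. ddist D u v \<le> ereal (real l))"

text \<open>Meaningful for \<open>k \<ge> 1\<close> only, because of the truncated subtraction.\<close>

definition k_kernel :: "('a,'b) pre_digraph \<Rightarrow> nat \<Rightarrow> 'a set \<Rightarrow> bool" where
  "k_kernel D k S \<longleftrightarrow> k_independent D k S \<and> l_absorbent D (k - 1) S"

end

theory Submission
  imports Defs
begin

text \<open>
  Consider the closure of the digraph with an arc from \<open>u\<close> to \<open>v\<close>, for distinct \<open>u\<close> and \<open>v\<close>,
  whenever there is a walk of length at most \<open>l\<close> from \<open>u\<close> to \<open>v\<close>. Its kernels (independent sets
  to which every other vertex sends an arc) are exactly the \<open>(l + 1)\<close>-kernels of the given digraph,
  so it suffices to find a kernel of the closure; the theorem is the case \<open>l = 2\<close>.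

  A finite digraph whose asymmetric arcs form no directed cycle has a kernel: a vertex all of whose
  out-neighbours are also in-neighbours can be put into the kernel, its in-neighbours discarded, and
  the rest treated by induction (\<open>kernel_if_asymmetric_part_acyclic\<close>).

  The asymmetric part of the closure is acyclic for a counting reason. If a walk of length at most
  \<open>l\<close> leads from \<open>u\<close> to \<open>v\<close> and none leads back, then the walk uses an asymmetric arc, as
  otherwise it could be reversed; hence its length is at most \<open>l\<close> times its number of asymmetric
  arcs. This estimate is additive, so a directed cycle of asymmetric arcs of the closure
  would unfold to a closed walk \<open>p\<close> in which the asymmetric arcs make up at least the fraction
  \<open>1 / l\<close> of all arcs. The hypothesis says that on every directed cycle the fraction is smaller,
  and this passes to closed walks because they decompose into cycles
  (\<open>few_asymmetric_arcs_on_closed_walk\<close>).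
\<close>

section \<open>Kernels of relations with acyclic asymmetric part\<close>

text \<open>
  A sink \<open>v\<close> of the asymmetric part exists by finiteness and acyclicity. The vertices kept for the
  induction have no arc to \<open>v\<close>, so by the choice of \<open>v\<close> they receive none from it either, and \<open>v\<close>
  may be added to any kernel of theirs.
\<close>

lemma kernel_if_asymmetric_part_acyclic:
  assumes "finite V" and "acyclic ((E - E\<inverse>) \<inter> V \<times> V)"
  shows "\<exists>S\<subseteq>V. (\<forall>u\<in>S. \<forall>v\<in>S. u \<noteq> v \<longrightarrow> (u, v) \<notin> E) \<and> (\<forall>u\<in>V - S. \<exists>v\<in>S. (u, v) \<in> E)"
  using assms
proof (induction V rule: finite_psubset_induct)
  case (psubset V)
  show ?case
  proof (cases "V = {}")
    case False
    define A where "A = (E - E\<inverse>) \<inter> V \<times> V"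
    have "finite A"
      using psubset.hyps by (simp add: A_def)
    then have "wf (A\<inverse>)"
      using psubset.prems by (simp add: A_def finite_acyclic_wf_converse)
    then obtain v where v: "v \<in> V" and no_out: "\<And>w. (v, w) \<in> A \<Longrightarrow> w \<notin> V"
      using False by (metis converse_iff wfE_min')
    have sym_at_v: "(w, v) \<in> E" if "w \<in> V" "(v, w) \<in> E" for w
      using that v no_out[of w] by (auto simp: A_def)
    define W where "W = {w \<in> V. w \<noteq> v \<and> (w, v) \<notin> E}"
    have "W \<subset> V"
      using v by (auto simp: W_def)
    moreover have "acyclic ((E - E\<inverse>) \<inter> W \<times> W)"
      using \<open>W \<subset> V\<close> by (intro acyclic_subset[OF psubset.prems]) auto
    ultimately obtain S where "S \<subseteq> W"
      and "\<forall>u\<in>S. \<forall>v\<in>S. u \<noteq> v \<longrightarrow> (u, v) \<notin> E" "\<forall>u\<in>W - S. \<exists>v\<in>S. (u, v) \<in> E"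
      using psubset.IH by meson
    then show ?thesis
      using v sym_at_v by (intro exI[of _ "insert v S"]) (auto simp: W_def)
  qed simp
qed

section \<open>Symmetric and asymmetric arcs on walks\<close>

context wf_digraph
begin

definition num_asymmetric_arcs :: "'b list \<Rightarrow> nat" where
  "num_asymmetric_arcs p = length (filter (\<lambda>a. \<not> symmetric_arc G a) p)"

lemma num_asymmetric_arcs_append [simp]:
  "num_asymmetric_arcs (p @ q) = num_asymmetric_arcs p + num_asymmetric_arcs q"
  by (simp add: num_asymmetric_arcs_def)

lemma num_symmetric_plus_num_asymmetric_arcs:
  assumes "distinct p"
  shows "num_symmetric_arcs G p + num_asymmetric_arcs p = length p"
proof -
  have "num_symmetric_arcs G p = length (filter (symmetric_arc G) p)"
    using assms by (simp add: num_symmetric_arcs_def distinct_length_filter Int_def conj_commute)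
  then show ?thesis
    using sum_length_filter_compl[of "symmetric_arc G" p] by (simp add: num_asymmetric_arcs_def)
qed

lemma reverse_awalk_if_symmetric:
  assumes "awalk u p v" and "\<And>a. a \<in> set p \<Longrightarrow> symmetric_arc G a"
  shows "\<exists>q. awalk v q u \<and> length q = length p"
  using assms
proof (induction p arbitrary: u)
  case Nil
  then show ?case
    by (auto simp: awalk_Nil_iff)
next
  case (Cons a p)
  then obtain q where q: "awalk v q (head G a)" "length q = length p"
    by (auto simp: awalk_Cons_iff)
  have "head G a \<rightarrow> u"
    using Cons.prems by (auto simp: awalk_Cons_iff symmetric_arc_def)
  then obtain b where "b \<in> arcs G" "tail G b = head G a" "head G b = u"
    by (auto simp: arcs_ends_conv)
  then have "awalk (head G a) [b] u"
    by (auto simp: awalk_simps)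
  with q show ?case
    by (intro exI[of _ "q @ [b]"]) auto
qed

text \<open>
  A vertex that a closed walk repeats splits it into two shorter closed walks; the strict
  inequality is additive and therefore passes from directed cycles to all closed walks.
\<close>

lemma few_asymmetric_arcs_on_closed_walk:
  assumes cyc: "\<And>B. cycle B \<Longrightarrow> l * num_asymmetric_arcs B < length B"
    and "awalk u p u" and "p \<noteq> []"
  shows "l * num_asymmetric_arcs p < length p"
  using assms(2,3)
proof (induction "length p" arbitrary: u p rule: less_induct)
  case less
  show ?case
  proof (cases "distinct (tl (awalk_verts u p))")
    case True
    then show ?thesis
      using less.prems by (intro cyc) (auto simp: cycle_def)
  next
    case False
    obtain e es where p: "p = e # es"
      using less.prems(2) by (cases p) auto
    have es: "awalk (head G e) es u" and "\<not> distinct (awalk_verts (head G e) es)"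
      using False less.prems(1) by (auto simp: p awalk_Cons_iff)
    then obtain q r s w where decomp: "es = q @ r @ s" "awalk (head G e) q w" "awalk w r w"
      "awalk w s u" "r \<noteq> []"
      using awalk_not_distinct_decomp by (metis length_greater_0_conv)
    \<comment> \<open>The two pieces are \<open>r\<close> and the rest of \<open>p\<close>, which is nonempty because it keeps \<open>e\<close>.\<close>
    have "awalk u (e # q @ s) u"
      using decomp less.prems(1) by (auto simp: p awalk_Cons_iff)
    then have "l * num_asymmetric_arcs (e # q @ s) < length (e # q @ s)"
      using decomp by (intro less.hyps[of _ u]) (auto simp: p)
    moreover have "l * num_asymmetric_arcs r < length r"
      using decomp by (intro less.hyps[of _ w]) (auto simp: p)
    moreover have "num_asymmetric_arcs p = num_asymmetric_arcs (e # q @ s) + num_asymmetric_arcs r"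
      by (simp add: p decomp(1) num_asymmetric_arcs_def)
    ultimately show ?thesis
      by (simp add: p decomp(1) distrib_left)
  qed
qed

section \<open>The closure under short walks\<close>

definition linked_within :: "nat \<Rightarrow> ('a \<times> 'a) set" where
  "linked_within l = {(u, v). \<exists>p. awalk u p v \<and> length p \<le> l}"

lemma ddist_le_if_within: "(u, v) \<in> linked_within l \<Longrightarrow> ddist G u v \<le> ereal (real l)"
  unfolding ddist_conv linked_within_def by (auto intro!: INF_lower2)

lemma ddist_ge_if_not_within: "(u, v) \<notin> linked_within l \<Longrightarrow> ereal (real (Suc l)) \<le> ddist G u v"
  unfolding ddist_conv linked_within_def by (force intro!: INF_greatest)

lemma k_kernel_if_kernel_of_within:
  assumes "S \<subseteq> verts G" and "\<forall>u\<in>S. \<forall>v\<in>S. u \<noteq> v \<longrightarrow> (u, v) \<notin> linked_within l"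
    and "\<forall>u\<in>verts G - S. \<exists>v\<in>S. (u, v) \<in> linked_within l"
  shows "k_kernel G (Suc l) S"
  using assms ddist_le_if_within ddist_ge_if_not_within
  unfolding k_kernel_def k_independent_def l_absorbent_def diff_Suc_1 by blast

text \<open>
  A one-way step of the closure needs a non-reversible walk, hence an asymmetric arc, hence a walk
  whose length is at most \<open>l\<close> times its number of asymmetric arcs; concatenation keeps this bound.
\<close>

lemma awalk_of_one_way_chain:
  assumes "(u, v) \<in> (linked_within l - (linked_within l)\<inverse>)\<^sup>+"
  shows "\<exists>p. awalk u p v \<and> p \<noteq> [] \<and> length p \<le> l * num_asymmetric_arcs p"
proof -
  have one: "\<exists>p. awalk x p y \<and> p \<noteq> [] \<and> length p \<le> l * num_asymmetric_arcs p"
    if "(x, y) \<in> linked_within l - (linked_within l)\<inverse>" for x y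
  proof -
    have no: "\<not> length q \<le> l" if "awalk y q x" for q
      using that \<open>(x, y) \<in> _\<close> by (auto simp: linked_within_def)
    obtain p where p: "awalk x p y" "length p \<le> l"
      using \<open>(x, y) \<in> _\<close> by (auto simp: linked_within_def)
    obtain a where a: "a \<in> set p" "\<not> symmetric_arc G a"
      using reverse_awalk_if_symmetric[OF p(1)] p(2) no by metis
    then have "1 \<le> num_asymmetric_arcs p"
      by (auto simp: num_asymmetric_arcs_def Suc_le_eq filter_empty_conv)
    then have "length p \<le> l * num_asymmetric_arcs p"
      using p(2) mult_le_mono2[of 1 "num_asymmetric_arcs p" l] by linarith
    with p(1) a(1) show ?thesis
      by auto
  qed
  show ?thesis
    using assms
  proof (induction rule: trancl_induct)
    case (base y)
    then show ?case
      by (rule one)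
  next
    case (step y z)
    then obtain p q where "awalk u p y" "p \<noteq> []" "length p \<le> l * num_asymmetric_arcs p"
      "awalk y q z" "length q \<le> l * num_asymmetric_arcs q"
      using one by blast
    then show ?case
      by (intro exI[of _ "p @ q"]) (auto simp: distrib_left)
  qed
qed

lemma acyclic_one_way_within:
  assumes "\<And>B. cycle B \<Longrightarrow> l * num_asymmetric_arcs B < length B"
  shows "acyclic (linked_within l - (linked_within l)\<inverse>)"
  unfolding acyclic_def
  using awalk_of_one_way_chain few_asymmetric_arcs_on_closed_walk[OF assms]
  by (meson linorder_not_le)

end

text \<open>
  The hypothesis is equivalent to requiring more than \<open>(k - 2) / (k - 1) * \<parallel>B\<parallel>\<close> symmetric arcs
  on each directed cycle \<open>B\<close>, where \<open>k = l + 1\<close> and \<open>k \<ge> 2\<close>.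
\<close>

theorem (in fin_digraph) k_kernel_if_few_asymmetric_arcs_on_cycles:
  assumes "\<And>B. cycle B \<Longrightarrow> l * num_asymmetric_arcs B < length B"
  shows "\<exists>S. k_kernel G (Suc l) S"
proof -
  have "acyclic ((linked_within l - (linked_within l)\<inverse>) \<inter> verts G \<times> verts G)"
    using acyclic_one_way_within[OF assms] by (rule acyclic_subset) auto
  from kernel_if_asymmetric_part_acyclic[OF finite_verts this]
  show ?thesis
    using k_kernel_if_kernel_of_within by blast
qed

theorem corollary8:
  fixes D :: "('a,'b) pre_digraph"
  assumes "digraph D"
    and "\<And>B. pre_digraph.cycle D B \<Longrightarrow>
           real (num_symmetric_arcs D B) \<ge> 1 / 2 * real (length B) + 1"
  shows "\<exists>S. k_kernel D 3 S"
proof -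
  interpret digraph D
    by fact
  have "2 * num_asymmetric_arcs B < length B" if "cycle B" for B
  proof -
    have "num_symmetric_arcs D B + num_asymmetric_arcs B = length B"
      using that by (intro num_symmetric_plus_num_asymmetric_arcs) (auto simp: cycle_conv)
    then show ?thesis
      using assms(2)[OF that] by linarith
  qed
  then have "\<exists>S. k_kernel D (Suc 2) S"
    by (rule k_kernel_if_few_asymmetric_arcs_on_cycles)
  then show ?thesis
    by simp
qed

end
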